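(* For every integer $n\ge 0$, the Fibonacci-Fubini number $\mathcal{F}_n$ is given by $$\mathcal{F}_n = \frac{1}{\sqrt{5}} \sum_{k=0}^{n}\sum_{j=0}^{k}(-1)^{k-j}\binom{k}{j} \frac{\alpha^{k+1}-\beta^{k+1}}{k!}\, j^n .$$
   Context: $\alpha=(1+\sqrt5)/2$ and $\beta=(1-\sqrt5)/2$. Convention: $0^0=1$. A permutation $\sigma=\sigma_1\cdots\sigma_k$ of $\{1,\dots,k\}$ is a Fibonacci permutation if $|\sigma_i-i|\le 1$ for every $i$. For a set partition of $[n]=\{1,\dots,n\}$ into non-empty blocks $B_1|B_2|\cdots|B_k$, the blocks are always listed so that $\min B_1<\min B_2<\cdots<\min B_k$. A Fibonacci ordered partition of $[n]$ is an arrangement $B_{\sigma_1}|B_{\sigma_2}|\cdots|B_{\sigma_k}$ where $B_1|\cdots|B_k$ is a partition of $[n]$ (any number $k$ of blocks) and $\sigma$ is a Fibonacci permutation of $\{1,\dots,k\}$. The Fibonacci-Fubini number $\mathcal{F}_n$ is the total number of Fibonacci ordered partitions of $[n]$ (for $n=0$ the empty partition with $k=0$ blocks is counted once, so $\mathcal{F}_0=1$). *)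

theory Defs
  imports Complex_Main "HOL-Library.Disjoint_Sets" "HOL-Combinatorics.Permutations"
begin

definition alpha :: real where "alpha = (1 + sqrt 5) / 2"

definition beta :: real where "beta = (1 - sqrt 5) / 2"

(* A permutation of {1..k} is a function on nat that is the identity outside {1..k};
   the distance is taken in int because subtraction on nat truncates. *)
definition fibonacci_permutation :: "nat \<Rightarrow> (nat \<Rightarrow> nat) \<Rightarrow> bool" where
  "fibonacci_permutation k \<sigma> \<longleftrightarrow>
     \<sigma> permutes {1..k} \<and> (\<forall>i\<in>{1..k}. \<bar>int (\<sigma> i) - int i\<bar> \<le> 1)"

(* The list B_1, ..., B_k of the blocks of a set partition of {1..n}, by increasing minima;
   the strict order makes the entries distinct, so k is the number of blocks. *)
definition standard_listing :: "nat \<Rightarrow> nat set list \<Rightarrow> bool" where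
  "standard_listing n Bs \<longleftrightarrow>
     partition_on {1..n} (set Bs) \<and> sorted_wrt (\<lambda>A B. Min A < Min B) Bs"

(* The arrangement B_(sigma 1) | ... | B_(sigma k); positions count from 1, list indices from 0. *)
definition arrange :: "(nat \<Rightarrow> nat) \<Rightarrow> 'a list \<Rightarrow> 'a list" where
  "arrange \<sigma> Bs = map (\<lambda>i. Bs ! (\<sigma> i - 1)) [1..<length Bs + 1]"

definition fibonacci_ordered_partitions :: "nat \<Rightarrow> nat set list set" where
  "fibonacci_ordered_partitions n =
     {arrange \<sigma> Bs | \<sigma> Bs. standard_listing n Bs \<and> fibonacci_permutation (length Bs) \<sigma>}"

definition fibonacci_fubini :: "nat \<Rightarrow> nat" where
  "fibonacci_fubini n = card (fibonacci_ordered_partitions n)"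

end

theory Submission
  imports Defs "HOL-Combinatorics.Stirling" "HOL-Number_Theory.Fib"
begin

text \<open>
  An arrangement determines its set of blocks, hence the standard listing, hence the permutation,
  since the blocks are distinct. So \<open>\<F>\<^sub>n\<close> is the sum of \<open>S(n,k) f\<^sub>k\<close> over \<open>k\<close>, where \<open>f\<^sub>k\<close> counts the
  Fibonacci permutations of \<open>{1..k}\<close>. Such a permutation either fixes \<open>k\<close> or swaps \<open>k\<close> with \<open>k - 1\<close>,
  so \<open>f\<^sub>k = fib (k + 1)\<close>. The formula now follows from Binet's formula and the explicit alternating
  sum for the Stirling numbers of the second kind.
\<close>

section \<open>The explicit formula for Stirling numbers of the second kind\<close>

text \<open>Absorption gives \<open>Suc k\<close> times the binomial with both indices lowered,
  which Pascal's rule turns into the difference. Both binomials then keep the lower index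
  \<open>j\<close>, so a sum over \<open>j\<close> splits without reindexing.\<close>

lemma binomial_times_lower_index:
  assumes "j \<le> Suc k"
  shows "real (Suc k choose j) * real j = real (Suc k) * (real (Suc k choose j) - real (k choose j))"
proof (cases j)
  case (Suc i)
  have "Suc i * (Suc k choose Suc i) = Suc k * (k choose i)"
    by (rule Suc_times_binomial)
  then have "real (Suc i) * real (Suc k choose Suc i) = real (Suc k) * real (k choose i)"
    by (metis of_nat_mult)
  with Suc show ?thesis
    by (simp add: mult.commute)
qed simp

text \<open>Both sides, divided by \<open>fact k\<close>, obey the recurrence that defines
  \<open>Stirling\<close>, with the same boundary values.\<close>

lemma Stirling_alternating_sum:
  "fact k * real (Stirling n k) = (\<Sum>j\<le>k. (-1) ^ (k - j) * real (k choose j) * real j ^ n)"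
proof (induction n k rule: Stirling.induct)
  case (2 k)
  \<comment> \<open>For exponent 0 every power of \<open>j\<close> is 1, including 0^0, so the sum
    is a binomial expansion with value 0.\<close>
  have "(\<Sum>j\<le>Suc k. (-1) ^ (Suc k - j) * real (Suc k choose j)) = ((1::real) + (-1)) ^ Suc k"
    by (subst binomial_ring) (simp add: mult.commute)
  then show ?case by simp
next
  case (4 n k)
  let ?s = "\<lambda>k j. (-1) ^ (k - j) :: real"
  have "(\<Sum>j\<le>Suc k. ?s (Suc k) j * real (Suc k choose j) * real j ^ Suc n)
      = (\<Sum>j\<le>Suc k. real (Suc k) * (?s (Suc k) j * real (Suc k choose j) * real j ^ n)
                   - real (Suc k) * (?s (Suc k) j * real (k choose j) * real j ^ n))"
  proof (rule sum.cong)
    fix j assume "j \<in> {..Suc k}"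
    then have eq: "real (Suc k choose j) * real j
        = real (Suc k) * (real (Suc k choose j) - real (k choose j))"
      using binomial_times_lower_index by simp
    have "?s (Suc k) j * real (Suc k choose j) * real j ^ Suc n
        = ?s (Suc k) j * (real (Suc k choose j) * real j) * real j ^ n"
      by (simp only: power_Suc mult_ac)
    also have "\<dots> = real (Suc k) * (?s (Suc k) j * real (Suc k choose j) * real j ^ n)
                   - real (Suc k) * (?s (Suc k) j * real (k choose j) * real j ^ n)"
      unfolding eq by (simp only: right_diff_distrib left_diff_distrib mult_ac)
    finally show "?s (Suc k) j * real (Suc k choose j) * real j ^ Suc n = \<dots>" .
  qed simp
  also have "\<dots> = real (Suc k) * (fact (Suc k) * real (Stirling n (Suc k)))
      - real (Suc k) * (\<Sum>j\<le>Suc k. ?s (Suc k) j * real (k choose j) * real j ^ n)"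
    by (simp only: sum_subtractf sum_distrib_left "4.IH")
  \<comment> \<open>The term \<open>j = Suc k\<close> vanishes with its binomial, and for
    \<open>j \<le> k\<close> lowering the exponent of -1 by one flips the sign.\<close>
  also have "(\<Sum>j\<le>Suc k. ?s (Suc k) j * real (k choose j) * real j ^ n)
      = - (\<Sum>j\<le>k. ?s k j * real (k choose j) * real j ^ n)"
    by (simp add: sum_negf [symmetric] Suc_diff_le)
  also have "\<dots> = - (fact k * real (Stirling n k))"
    by (simp only: "4.IH")
  finally show ?case
    by (simp add: algebra_simps)
qed simp_all

section \<open>Set partitions counted by their number of blocks\<close>

text \<open>Either \<open>{a}\<close> is a block by itself, or deleting \<open>a\<close> from its
  block leaves a partition of \<open>A\<close> with one block marked. The \<open>Suc k\<close>
  choices of the mark give the factor.\<close>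

lemma card_partitions_insert:
  assumes "finite A" "a \<notin> A"
  shows "card {P. partition_on (insert a A) P \<and> card P = Suc k}
       = Suc k * card {P. partition_on A P \<and> card P = Suc k} + card {P. partition_on A P \<and> card P = k}"
proof -
  let ?part = "\<lambda>A k. {P. partition_on A P \<and> card P = k}"
  \<comment> \<open>\<open>S\<close> holds the partitions with a marked block, and
    \<open>adjoin\<close> puts \<open>a\<close> into that block.\<close>
  define adjoin where "adjoin = (\<lambda>(P, B). insert (insert a B) (P - {B}))"
  define S where "S = (SIGMA P : ?part A (Suc k). P)"
  have fin: "finite (?part A k)" "finite (?part A (Suc k))" for k
    using finitely_many_partition_on[OF \<open>finite A\<close>] by (auto intro: finite_subset[rotated])
  have finP: "finite P" if "partition_on A P" for P
    using finite_elements[OF \<open>finite A\<close> that] .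
  have notin: "a \<notin> B" if "partition_on A P" "B \<in> P" for P B
    using that \<open>a \<notin> A\<close> by (auto simp: partition_on_def)
  have inj1: "inj_on (insert {a}) (?part A k)"
  proof (rule inj_on_inverseI[where g = "\<lambda>Q. Q - {{a}}"])
    fix P assume "P \<in> ?part A k"
    then have "{a} \<notin> P" using notin[of P "{a}"] by auto
    then show "insert {a} P - {{a}} = P" by simp
  qed
  \<comment> \<open>The block containing \<open>a\<close> reveals the marked block. This serves both
    for injectivity of \<open>adjoin\<close> and for separating its image from the partitions with
    block \<open>{a}\<close>.\<close>
  have block: "C = insert a B" if "(P, B) \<in> S" "C \<in> adjoin (P, B)" "a \<in> C" for P B C
    using that notin[of P C] by (auto simp: S_def adjoin_def)
  have inj2: "inj_on adjoin S"
  proof (rule inj_onI, clarify)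
    fix P B Q C
    assume PB: "(P, B) \<in> S" and QC: "(Q, C) \<in> S" and eq: "adjoin (P, B) = adjoin (Q, C)"
    have "insert a B \<in> adjoin (P, B)"
      by (simp add: adjoin_def)
    then have "insert a B = insert a C"
      using block[OF QC] eq by auto
    moreover have "a \<notin> B" "a \<notin> C"
      using PB QC notin[of P B] notin[of Q C] by (auto simp: S_def)
    ultimately have BC: "B = C" by auto
    have recover: "R = insert D (adjoin (R, D) - {insert a D})" if "(R, D) \<in> S" for R D
    proof -
      have "insert a D \<notin> R" "D \<in> R"
        using that notin[of R "insert a D"] by (auto simp: S_def)
      then show ?thesis by (auto simp: adjoin_def)
    qed
    have "P = insert B (adjoin (P, B) - {insert a B})" by (rule recover[OF PB])
    also have "\<dots> = insert C (adjoin (Q, C) - {insert a C})" by (simp only: eq[unfolded BC] BC)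
    also have "\<dots> = Q" by (rule recover[OF QC, symmetric])
    finally show "P = Q \<and> B = C" using BC by blast
  qed
  have cardS: "card S = Suc k * card (?part A (Suc k))"
    using fin finP unfolding S_def by (subst card_SigmaI) auto
  have disj: "insert {a} ` ?part A k \<inter> adjoin ` S = {}"
  proof -
    have "insert {a} P \<noteq> adjoin (Q, B)" if "(Q, B) \<in> S" for P Q B
    proof
      assume eq: "insert {a} P = adjoin (Q, B)"
      have "{a} = insert a B"
        using block[OF that, of "{a}"] eq by blast
      moreover have "B \<noteq> {}" "a \<notin> B"
        using that notin[of Q B] by (auto simp: S_def partition_on_def)
      ultimately show False by blast
    qed
    then show ?thesis by auto
  qed
  have "?part (insert a A) (Suc k) = insert {a} ` ?part A k \<union> adjoin ` S" (is "?L = ?R")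
  proof (rule Set.equalityI; rule subsetI)
    fix Q assume "Q \<in> ?L"
    then have Q: "partition_on (insert a A) Q" and cQ: "card Q = Suc k" by auto
    then have finQ: "finite Q" by (intro card_ge_0_finite) simp
    obtain C where C: "C \<in> Q" "a \<in> C"
      using partition_onD1[OF Q] by blast
    have dj: "disjnt C (\<Union>(Q - {C}))"
      using partition_onD2[OF Q] C by (auto simp: disjoint_def disjnt_def)
    have "insert C (Q - {C}) = Q" using C by auto
    then have rest: "partition_on (insert a A - C) (Q - {C})" and "C \<subseteq> insert a A"
      using partition_on_insert[OF dj, of "insert a A"] Q by auto
    show "Q \<in> ?R"
    proof (cases "C = {a}")
      case True
      then have "insert a A - C = A" using \<open>a \<notin> A\<close> by auto
      with rest have "Q - {C} \<in> ?part A k" using finQ C cQ by auto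
      moreover have "Q = insert {a} (Q - {C})" using True C by auto
      ultimately show ?thesis by blast
    next
      case False
      \<comment> \<open>Since \<open>C\<close> is not \<open>{a}\<close>, deleting \<open>a\<close>
        leaves a nonempty block; it is disjoint from the other blocks, hence distinct from them, and
        the number of blocks is unchanged.\<close>
      define B where "B = C - {a}"
      have B: "B \<noteq> {}" "B \<subseteq> A" "a \<notin> B" "insert a B = C" 
        using False C \<open>C \<subseteq> insert a A\<close> by (auto simp: B_def)
      have djB: "disjnt B (\<Union>(Q - {C}))"
        using dj by (auto simp: B_def disjnt_def)
      then have BQ: "B \<notin> Q - {C}"
        using \<open>B \<noteq> {}\<close> by (auto simp: disjnt_def)
      have "insert a A - C = A - B" using B \<open>a \<notin> A\<close> by auto
      then have "partition_on A (insert B (Q - {C}))"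
        using partition_on_insert[OF djB] B rest by simp
      moreover have "card (insert B (Q - {C})) = Suc k"
        using finQ BQ C cQ by simp
      ultimately have "(insert B (Q - {C}), B) \<in> S" by (auto simp: S_def)
      moreover have "Q = adjoin (insert B (Q - {C}), B)"
        using BQ B C by (auto simp: adjoin_def)
      ultimately show ?thesis by blast
    qed
  next
    fix Q assume "Q \<in> ?R"
    then consider (single) P where "P \<in> ?part A k" "Q = insert {a} P"
      | (adjoin) P B where "(P, B) \<in> S" "Q = adjoin (P, B)"
      by (elim UnE imageE) (blast, metis surj_pair)
    then show "Q \<in> ?L"
    proof cases
      case single
      then have P: "partition_on A P" by simp
      have dj: "disjnt {a} (\<Union>P)" and "insert a A - {a} = A"
        using partition_onD1[OF P] \<open>a \<notin> A\<close> by auto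
      then have "partition_on (insert a A) (insert {a} P)"
        using P by (simp add: partition_on_insert)
      moreover have "{a} \<notin> P" using notin[OF P] by auto
      ultimately show ?thesis using single finP by simp
    next
      case adjoin
      then have P: "partition_on A P" "card P = Suc k" and B: "B \<in> P" by (auto simp: S_def)
      have dj: "disjnt B (\<Union>(P - {B}))"
        using partition_onD2[OF P(1)] B by (auto simp: disjoint_def disjnt_def)
      moreover have "insert B (P - {B}) = P" using B by auto
      ultimately have "partition_on (A - B) (P - {B})" "B \<subseteq> A"
        using partition_on_insert[OF dj, of A] P by auto
      moreover have "insert a A - insert a B = A - B" using \<open>a \<notin> A\<close> by auto
      moreover have dj': "disjnt (insert a B) (\<Union>(P - {B}))"
        using dj notin[OF P(1)] by (auto simp: disjnt_def)
      ultimately have "partition_on (insert a A) (insert (insert a B) (P - {B}))"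
        by (subst partition_on_insert[OF dj']) auto
      moreover have "insert a B \<notin> P - {B}" using notin[OF P(1)] by auto
      ultimately show ?thesis
        using adjoin P B finP[OF P(1)] by (simp add: adjoin_def)
    qed
  qed
  moreover have "finite S"
    unfolding S_def using fin finP by (intro finite_SigmaI) auto
  ultimately show ?thesis
    using fin disj by (simp add: card_Un_disjoint card_image inj1 inj2 cardS)
qed

lemma card_partitions_Stirling:
  assumes "finite A"
  shows "card {P. partition_on A P \<and> card P = k} = Stirling (card A) k"
  using assms
proof (induction A arbitrary: k rule: finite_induct)
  case empty
  have "{P :: 'a set set. P = {} \<and> card P = k} = (if k = 0 then {{}} else {})"
    by auto
  then show ?case by (cases k) (simp_all add: partition_on_empty)
next
  case (insert a A)
  show ?case
  proof (cases k)
    case 0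
    have "card P \<noteq> 0" if "partition_on (insert a A) P" for P
    proof -
      have "finite P" using finite_elements[OF _ that] insert.hyps(1) by simp
      moreover have "P \<noteq> {}" using partition_onD1[OF that] by blast
      ultimately show ?thesis by simp
    qed
    then have "{P. partition_on (insert a A) P \<and> card P = 0} = {}" by blast
    moreover have "Stirling (card (insert a A)) 0 = 0"
      using insert.hyps by simp
    ultimately show ?thesis by (simp only: 0 card.empty)
  next
    case (Suc k)
    then show ?thesis
      by (simp only: card_partitions_insert[OF insert.hyps] card_insert_disjoint[OF insert.hyps]
          insert.IH Stirling.simps add.commute)
  qed
qed

section \<open>Counting Fibonacci permutations\<close>

text \<open>The top index can only move down by one. The top value must still be attained, and only
  the neighbouring index is close enough.\<close>

lemma fibonacci_permutation_swap_last:
  assumes "fibonacci_permutation (Suc (Suc k)) \<sigma>" "\<sigma> (Suc (Suc k)) \<noteq> Suc (Suc k)"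
  shows "\<sigma> (Suc (Suc k)) = Suc k" "\<sigma> (Suc k) = Suc (Suc k)"
proof -
  have perm: "\<sigma> permutes {1..Suc (Suc k)}"
    and near: "\<And>i. i \<in> {1..Suc (Suc k)} \<Longrightarrow> \<bar>int (\<sigma> i) - int i\<bar> \<le> 1"
    using assms by (auto simp: fibonacci_permutation_def)
  have "\<sigma> (Suc (Suc k)) \<in> {1..Suc (Suc k)}"
    using perm by (simp only: permutes_in_image) simp
  then show "\<sigma> (Suc (Suc k)) = Suc k"
    using near[of "Suc (Suc k)"] assms(2) by auto
  obtain i where i: "i \<in> {1..Suc (Suc k)}" "\<sigma> i = Suc (Suc k)"
    using permutes_image[OF perm] by (metis (no_types, lifting) atLeastAtMost_iff imageE le_add1 order_refl plus_1_eq_Suc)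
  with near[of i] assms(2) have "i = Suc k"
    by (cases "i = Suc (Suc k)") auto
  with i show "\<sigma> (Suc k) = Suc (Suc k)" by simp
qed

text \<open>The two sets correspond to fixing the top index and to swapping the last two. As
  permutations are the identity outside their domain, the first set is literally that for
  \<open>Suc k\<close>, with no extension map.\<close>

lemma fibonacci_permutations_rec:
  "{\<sigma>. fibonacci_permutation (Suc (Suc k)) \<sigma>} =
     {\<sigma>. fibonacci_permutation (Suc k) \<sigma>}
     \<union> (\<lambda>\<sigma>. \<sigma> \<circ> Transposition.transpose (Suc k) (Suc (Suc k))) ` {\<sigma>. fibonacci_permutation k \<sigma>}"
  (is "?L = ?M \<union> ?t ` ?N")
proof (rule Set.equalityI; rule subsetI)
  fix \<sigma> assume "\<sigma> \<in> ?L"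
  then have fib: "fibonacci_permutation (Suc (Suc k)) \<sigma>" by simp
  then have perm: "\<sigma> permutes {1..Suc (Suc k)}"
    by (simp add: fibonacci_permutation_def)
  show "\<sigma> \<in> ?M \<union> ?t ` ?N"
  proof (cases "\<sigma> (Suc (Suc k)) = Suc (Suc k)")
    case True
    have "\<sigma> permutes {1..Suc k}"
      by (rule permutes_superset[OF perm]) (use True in \<open>auto simp: le_Suc_eq\<close>)
    with fib show ?thesis by (auto simp: fibonacci_permutation_def)
  next
    case False
    note swap = fibonacci_permutation_swap_last[OF fib False]
    \<comment> \<open>Composing with the transposition undoes the swap: both top indices become
      fixed, and the values on \<open>{1..k}\<close> do not change.\<close>
    have "?t \<sigma> permutes {1..Suc (Suc k)}"
      by (intro permutes_compose permutes_swap_id perm) auto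
    then have "?t \<sigma> permutes {1..k}"
      by (rule permutes_superset) (use swap in \<open>auto simp: le_Suc_eq\<close>)
    moreover have "?t \<sigma> i = \<sigma> i" if "i \<in> {1..k}" for i
      using that by simp
    ultimately have "?t \<sigma> \<in> ?N"
      using fib by (simp add: fibonacci_permutation_def)
    moreover have "\<sigma> = ?t (?t \<sigma>)"
      by (simp add: comp_assoc)
    ultimately show ?thesis by blast
  qed
next
  fix \<sigma> assume "\<sigma> \<in> ?M \<union> ?t ` ?N"
  then consider "\<sigma> \<in> ?M" | \<tau> where "\<tau> \<in> ?N" "\<sigma> = ?t \<tau>" by blast
  then show "\<sigma> \<in> ?L"
  proof cases
    case 1
    then have perm: "\<sigma> permutes {1..Suc k}" by (simp add: fibonacci_permutation_def)
    then have "\<sigma> permutes {1..Suc (Suc k)}" by (rule permutes_subset) auto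
    moreover have "\<sigma> (Suc (Suc k)) = Suc (Suc k)"
      using perm by (simp add: permutes_not_in)
    ultimately show ?thesis using 1 by (auto simp: fibonacci_permutation_def le_Suc_eq)
  next
    case 2
    then have perm: "\<tau> permutes {1..k}" by (simp add: fibonacci_permutation_def)
    then have "\<tau> permutes {1..Suc (Suc k)}" by (rule permutes_subset) auto
    then have "?t \<tau> permutes {1..Suc (Suc k)}"
      by (intro permutes_compose permutes_swap_id) auto
    moreover have "\<tau> (Suc (Suc k)) = Suc (Suc k)" "\<tau> (Suc k) = Suc k"
      using perm by (simp_all add: permutes_not_in)
    ultimately show ?thesis
      using 2 by (auto simp: fibonacci_permutation_def le_Suc_eq)
  qed
qed

lemma finite_fibonacci_permutations: "finite {\<sigma>. fibonacci_permutation k \<sigma>}"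
  by (rule finite_subset[OF _ finite_permutations[of "{1..k}"]]) (auto simp: fibonacci_permutation_def)

lemma card_fibonacci_permutations: "card {\<sigma>. fibonacci_permutation k \<sigma>} = fib (Suc k)"
proof (induction k rule: fib.induct)
  case 1
  \<comment> \<open>The empty permutation is represented by \<open>id\<close>; it is the one that
    counts the empty partition.\<close>
  have "{\<sigma>. fibonacci_permutation 0 \<sigma>} = {id}" by (auto simp: fibonacci_permutation_def)
  then show ?case by simp
next
  case 2
  have "{\<sigma>. fibonacci_permutation (Suc 0) \<sigma>} = {id}" by (auto simp: fibonacci_permutation_def)
  then show ?case by simp
next
  case (3 k)
  let ?t = "\<lambda>\<sigma>. \<sigma> \<circ> Transposition.transpose (Suc k) (Suc (Suc k)) :: nat \<Rightarrow> nat"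
  have "inj_on ?t {\<sigma>. fibonacci_permutation k \<sigma>}"
    by (rule inj_on_inverseI[where g = ?t]) (simp add: comp_assoc)
  \<comment> \<open>The value at \<open>Suc (Suc k)\<close> tells the two kinds apart.\<close>
  moreover have "{\<sigma>. fibonacci_permutation (Suc k) \<sigma>} \<inter> ?t ` {\<sigma>. fibonacci_permutation k \<sigma>} = {}"
  proof -
    have "\<sigma> (Suc (Suc k)) = Suc (Suc k)" if "fibonacci_permutation (Suc k) \<sigma>" for \<sigma>
      using that by (auto simp: fibonacci_permutation_def permutes_not_in)
    moreover have "?t \<sigma> (Suc (Suc k)) = Suc k" if "fibonacci_permutation k \<sigma>" for \<sigma>
      using that by (auto simp: fibonacci_permutation_def permutes_not_in)
    ultimately show ?thesis by force
  qed
  ultimately show ?case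
    unfolding fibonacci_permutations_rec
    by (simp add: card_Un_disjoint finite_fibonacci_permutations card_image 3)
qed

section \<open>Standard listings and their arrangements\<close>

lemma standard_listing_distinct:
  assumes "standard_listing n Bs"
  shows "distinct Bs"
  using assms by (auto simp: standard_listing_def distinct_conv_nth sorted_wrt_iff_nth_less)
    (metis linorder_neqE_nat less_irrefl)

lemma finite_block:
  assumes "finite A" "partition_on A P" "B \<in> P"
  shows "finite B"
proof (rule finite_subset[OF _ \<open>finite A\<close>])
  show "B \<subseteq> A" using assms by (auto simp: partition_on_def)
qed

text \<open>Blocks with equal minima share that element, and distinct blocks are disjoint.\<close>

lemma inj_on_Min_partition:
  assumes "partition_on A P" "\<And>B. B \<in> P \<Longrightarrow> finite B"
  shows "inj_on Min P"
proof (rule inj_onI)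
  fix B C assume BC: "B \<in> P" "C \<in> P" "Min B = Min C"
  then have "Min B \<in> B" "Min B \<in> C"
    using assms Min_in partition_onD3[OF assms(1)] by metis+
  with BC show "B = C"
    using partition_onD2[OF assms(1)] by (auto simp: disjoint_def)
qed

text \<open>Distinct blocks have distinct minima, so sorting by minimum lists the blocks in exactly
  one way. This lets sums over listings become sums over partitions.\<close>

lemma bij_betw_set_standard_listing:
  "bij_betw set {Bs. standard_listing n Bs} {P. partition_on {1..n} P}"
proof -
  have inj: "inj_on Min P" if "partition_on {1..n} P" for P
    using that by (rule inj_on_Min_partition)
      (rule finite_block[OF finite_atLeastAtMost that])
  show ?thesis
  proof (rule bij_betwI')
    fix Bs Cs assume "Bs \<in> {Bs. standard_listing n Bs}" "Cs \<in> {Bs. standard_listing n Bs}"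
    then have Bs: "standard_listing n Bs" and Cs: "standard_listing n Cs" by auto
    show "set Bs = set Cs \<longleftrightarrow> Bs = Cs"
    proof
      assume eq: "set Bs = set Cs"
      \<comment> \<open>The lists of minima are strictly increasing with the same entries, hence
        equal; injectivity of \<open>Min\<close> carries this back to the blocks.\<close>
      have "sorted_wrt (<) (map Min Cs)" "sorted_wrt (<) (map Min Bs)"
        using Bs Cs by (auto simp: standard_listing_def sorted_wrt_map)
      moreover have "set (map Min Bs) = set (map Min Cs)" using eq by simp
      ultimately have "map Min Bs = map Min Cs" by (rule strict_sorted_equal)
      moreover have "inj_on Min (set Bs \<union> set Cs)"
        using inj Bs eq by (auto simp: standard_listing_def)
      ultimately show "Bs = Cs" by (simp add: inj_on_map_eq_map)
    qed simp
  next
    fix Bs assume "Bs \<in> {Bs. standard_listing n Bs}"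
    then show "set Bs \<in> {P. partition_on {1..n} P}" by (simp add: standard_listing_def)
  next
    fix P assume "P \<in> {P. partition_on {1..n} P}"
    then have P: "partition_on {1..n} P" by simp
    have finP: "finite P" using finite_elements[OF _ P] by simp
    \<comment> \<open>The witness sorts the minima and replaces each by the block it comes
      from.\<close>
    define Bs where "Bs = map (the_inv_into P Min) (sorted_list_of_set (Min ` P))"
    have set: "set Bs = P"
      using finP inj[OF P] by (force simp: Bs_def the_inv_into_f_f)
    have "map Min Bs = sorted_list_of_set (Min ` P)"
      unfolding Bs_def map_map
      by (rule map_idI) (use finP inj[OF P] in \<open>auto simp: the_inv_into_f_f\<close>)
    then have "sorted_wrt (<) (map Min Bs)" by simp
    then have "standard_listing n Bs"
      using P set by (simp add: standard_listing_def sorted_wrt_map)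
    with set show "\<exists>Bs\<in>{Bs. standard_listing n Bs}. P = set Bs" by blast
  qed
qed

lemma set_arrange:
  assumes "\<sigma> permutes {1..length Bs}"
  shows "set (arrange \<sigma> Bs) = set Bs"
proof -
  have "set (arrange \<sigma> Bs) = (\<lambda>i. Bs ! (i - 1)) ` \<sigma> ` {1..length Bs}"
    by (auto simp: arrange_def image_image simp del: upt_Suc)
  also have "\<dots> = (\<lambda>i. Bs ! (i - 1)) ` Suc ` {..<length Bs}"
    by (simp only: permutes_image[OF assms] image_Suc_lessThan)
  also have "\<dots> = set Bs"
    by (simp add: image_image set_conv_nth) blast
  finally show ?thesis .
qed

lemma arrange_inject:
  assumes "\<sigma> permutes {1..length Bs}" "\<tau> permutes {1..length Bs}" "distinct Bs"
    and eq: "arrange \<sigma> Bs = arrange \<tau> Bs"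
  shows "\<sigma> = \<tau>"
proof
  fix i
  show "\<sigma> i = \<tau> i"
  proof (cases "i \<in> {1..length Bs}")
    case True
    then have "Bs ! (\<sigma> i - 1) = Bs ! (\<tau> i - 1)"
      using eq by (auto simp: arrange_def simp del: upt_Suc)
    \<comment> \<open>Both values are at least 1, so truncated subtraction of 1 loses nothing, and
      the resulting list indices are in range.\<close>
    moreover have "\<sigma> i \<in> {1..length Bs}" "\<tau> i \<in> {1..length Bs}"
      using True assms(1,2) by (simp_all only: permutes_in_image)
    ultimately show ?thesis
      using nth_eq_iff_index_eq[OF \<open>distinct Bs\<close>, of "\<sigma> i - 1" "\<tau> i - 1"]
      unfolding atLeastAtMost_iff by linarith
  next
    case False
    then show ?thesis using assms(1,2) by (simp add: permutes_not_in)
  qed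
qed

section \<open>Counting Fibonacci ordered partitions\<close>

text \<open>Pairs of a listing and a permutation are counted instead of arrangements, and each
  listing is then replaced by its set of blocks.\<close>

lemma fibonacci_fubini_eq_sum_partitions:
  "fibonacci_fubini n = (\<Sum>P | partition_on {1..n} P. fib (Suc (card P)))"
proof -
  let ?L = "{Bs. standard_listing n Bs}"
  let ?S = "SIGMA Bs : ?L. {\<sigma>. fibonacci_permutation (length Bs) \<sigma>}"
  note bij = bij_betw_set_standard_listing[of n]
  have "inj_on (\<lambda>(Bs, \<sigma>). arrange \<sigma> Bs) ?S"
  proof (rule inj_onI, clarify)
    fix Bs \<sigma> Cs \<tau>
    assume Bs: "standard_listing n Bs" and \<sigma>: "fibonacci_permutation (length Bs) \<sigma>"
      and Cs: "standard_listing n Cs" and \<tau>: "fibonacci_permutation (length Cs) \<tau>"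
      and eq: "arrange \<sigma> Bs = arrange \<tau> Cs"
    \<comment> \<open>Rearranging keeps the set of blocks, so the listing is recovered first and the
      permutation only afterwards.\<close>
    have "set Bs = set Cs"
      using \<sigma> \<tau> eq set_arrange unfolding fibonacci_permutation_def by metis
    then have "Bs = Cs"
      using Bs Cs bij_betw_imp_inj_on[OF bij] by (auto dest: inj_onD)
    moreover have "\<sigma> = \<tau>"
      using \<sigma> \<tau> eq \<open>Bs = Cs\<close> standard_listing_distinct[OF Bs]
      by (auto simp: fibonacci_permutation_def intro: arrange_inject)
    ultimately show "Bs = Cs \<and> \<sigma> = \<tau>" by simp
  qed
  moreover have "fibonacci_ordered_partitions n = (\<lambda>(Bs, \<sigma>). arrange \<sigma> Bs) ` ?S"
    by (force simp: fibonacci_ordered_partitions_def)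
  ultimately have "fibonacci_fubini n = card ?S"
    by (simp add: fibonacci_fubini_def card_image)
  also have "\<dots> = (\<Sum>Bs\<in>?L. fib (Suc (length Bs)))"
    using bij_betw_finite[OF bij] finitely_many_partition_on[of "{1..n}"]
    by (subst card_SigmaI) (auto simp: finite_fibonacci_permutations card_fibonacci_permutations)
  \<comment> \<open>Distinctness lets the summand depend on \<open>set Bs\<close> alone, as
    reindexing along \<open>set\<close> requires.\<close>
  also have "\<dots> = (\<Sum>Bs\<in>?L. fib (Suc (card (set Bs))))"
    by (rule sum.cong) (auto simp: distinct_card standard_listing_distinct)
  also have "\<dots> = (\<Sum>P | partition_on {1..n} P. fib (Suc (card P)))"
    by (rule sum.reindex_bij_betw[OF bij])
  finally show ?thesis .
qed

text \<open>Each block contributes at least one element. The bound allows sums over the number of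
  blocks of a partition of \<open>{1..n}\<close> to stop at \<open>n\<close>.\<close>

lemma card_partition_le:
  assumes "finite A" "partition_on A P"
  shows "card P \<le> card A"
proof -
  note fin = finite_block[OF assms]
  have "(\<Sum>B\<in>P. 1) \<le> (\<Sum>B\<in>P. card B)"
    using fin partition_onD3[OF assms(2)] by (intro sum_mono) (metis One_nat_def Suc_leI card_gt_0_iff)
  then show ?thesis
    using product_partition[OF assms(2) fin] by simp
qed

lemma fibonacci_fubini_eq_sum_Stirling:
  "fibonacci_fubini n = (\<Sum>k\<le>n. Stirling n k * fib (Suc k))"
proof -
  let ?Q = "{P. partition_on {1..n} P}"
  \<comment> \<open>Partitions are grouped by their number of blocks, on which the summand is
    constant.\<close>
  have "fibonacci_fubini n = (\<Sum>k\<le>n. \<Sum>P | P \<in> ?Q \<and> card P = k. fib (Suc (card P)))"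
    unfolding fibonacci_fubini_eq_sum_partitions
    using card_partition_le[of "{1..n}"] finitely_many_partition_on[of "{1..n}"]
    by (intro sum.group[symmetric]) auto
  also have "\<dots> = (\<Sum>k\<le>n. Stirling n k * fib (Suc k))"
    using card_partitions_Stirling[of "{1..n}"] by (intro sum.cong) auto
  finally show ?thesis .
qed

theorem theorem1:
  fixes n :: nat
  shows "real (fibonacci_fubini n) =
    1 / sqrt 5 * (\<Sum>k=0..n. \<Sum>j=0..k.
      (-1) ^ (k - j) * real (k choose j) * ((alpha ^ (k + 1) - beta ^ (k + 1)) / fact k) * real j ^ n)"
proof -
  \<comment> \<open>The formula holds separately for each \<open>k\<close>: \<open>fact k\<close>
    comes from the Stirling number and \<open>sqrt 5\<close> from Binet's formula.\<close>
  have "real (Stirling n k * fib (Suc k)) = 1 / sqrt 5 * (\<Sum>j=0..k.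
      (-1) ^ (k - j) * real (k choose j) * ((alpha ^ (k + 1) - beta ^ (k + 1)) / fact k) * real j ^ n)"
    for k
  proof -
    have "real (Stirling n k) = (\<Sum>j\<le>k. (-1) ^ (k - j) * real (k choose j) * real j ^ n) / fact k"
      by (simp add: Stirling_alternating_sum[symmetric])
    moreover have "real (fib (Suc k)) = (alpha ^ (k + 1) - beta ^ (k + 1)) / sqrt 5"
      by (simp only: fib_closed_form alpha_def beta_def Suc_eq_plus1)
    ultimately show ?thesis
      by (simp only: of_nat_mult atMost_atLeast0 sum_distrib_left sum_distrib_right sum_divide_distrib
          times_divide_eq_left times_divide_eq_right divide_divide_eq_left mult_ac mult_1_right mult_1_left)
  qed
  then show ?thesis
    by (simp only: fibonacci_fubini_eq_sum_Stirling of_nat_sum atMost_atLeast0 sum_distrib_left)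
qed

end
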